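(* Let $\Omega \subseteq \mathbb{R}$ be a bounded Lebesgue measurable set with $\Omega \cap (-\epsilon,\epsilon) = \emptyset$ for some $\epsilon > 0$, and let $A \subseteq \mathbb{R}\setminus\{0\}$ be a discrete set such that $A\cdot\Omega$ is a multiplicative tiling of $\mathbb{R}$ at level 1. Let $\Omega^+ = \Omega\cap(0,+\infty)$, $\Omega^- = -(\Omega\cap(-\infty,0))$, $A^+ = A\cap(0,+\infty)$, $A^- = -(A\cap(-\infty,0))$, and let $\omega^\pm = \log\Omega^\pm$, $a^\pm = \log A^\pm$. Suppose that $\Omega$ is not essentially symmetric, i.e. $|\Omega^+\triangle\Omega^-|>0$, and that (after scaling) $$a^+ = \mathbb{Z} + \tfrac1L \alpha^+,\qquad a^- = \mathbb{Z}+\tfrac1L\alpha^-$$ for some positive integer $L$ and some $\alpha^+,\alpha^-\subseteq \mathbb{Z}_L = \mathbb{Z}/L\mathbb{Z}$ with $0\in\alpha^+$. Then, for each of $\omega^+$ and $\omega^-$, almost all of its points are distinct mod $1$, and, identifying $\omega^\pm$ with their projections to $\mathbb{T} = \mathbb{R}/\mathbb{Z}$, there are sets $b_x^+, b_x^-\subseteq\mathbb{Z}_L$ ($x\in[0,1/L)$) such that $$\omega^+ = \bigcup_{x\in[0,1/L)}\left(x+\tfrac1L b_x^+\right),\qquad \omega^- = \bigcup_{x\in[0,1/L)}\left(x+\tfrac1L b_x^-\right)\qquad\text{(disjoint unions)},$$ and such that for almost every $x\in[0,1/L)$ both of the following are tilings of $\mathbb{Z}_L$: $$\mathbb{Z}_L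 = (b_x^+ + \alpha^+)\cup(b_x^-+\alpha^-),\qquad \mathbb{Z}_L = (b_x^++\alpha^-)\cup(b_x^-+\alpha^+).$$
   Context: For a discrete set $A\subseteq\mathbb{R}\setminus\{0\}$ and a measurable set $\Omega\subseteq\mathbb{R}$, $A\cdot\Omega$ is a multiplicative tiling of $\mathbb{R}$ at level $1$ if $\sum_{a\in A}\mathbf{1}_\Omega(a^{-1}x) = 1$ for almost every $x\in\mathbb{R}$. $|\cdot|$ is Lebesgue measure, $\triangle$ is symmetric difference, and $\log E = \{\log x: x\in E\}$ for $E\subseteq(0,\infty)$. For $k\in\mathbb{Z}_L$, $k/L$ is a well-defined point of $\mathbb{T}=\mathbb{R}/\mathbb{Z}$; $\mathbb{Z}+\frac1L\alpha^\pm$ denotes the set of all reals whose class mod 1 is $k/L$ for some $k\in\alpha^\pm$. "Almost all points of $\omega^\pm$ are distinct mod 1" means that for every nonzero integer $n$ the set $\omega^\pm\cap(\omega^\pm+n)$ has measure zero. For $B,C,D,E\subseteq \mathbb{Z}_L$, "$\mathbb{Z}_L=(B+C)\cup(D+E)$ is a tiling" means that every element of $\mathbb{Z}_L$ is represented exactly once in total, either as $b+c$ with $(b,c)\in B\times C$ or as $d+e$ with $(d,e)\in D\times E$; equivalently $\mathbf 1_B*\mathbf 1_C+\mathbf 1_D*\mathbf 1_E\equiv 1$ on $\mathbb{Z}_L$. *)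

theory Defs
  imports "HOL-Analysis.Analysis"
begin

definition pos_part :: "real set \<Rightarrow> real set" where
  "pos_part S = S \<inter> {0<..}"

definition neg_part :: "real set \<Rightarrow> real set" where
  "neg_part S = uminus ` (S \<inter> {..<0})"

definition multiplicative_tiling :: "real set \<Rightarrow> real set \<Rightarrow> bool" where
  "multiplicative_tiling A \<Omega> \<longleftrightarrow>
     (AE x in lebesgue. ((\<lambda>a. indicat_real \<Omega> (inverse a * x)) has_sum 1) A)"

text \<open>Elements of \<open>\<int>/L\<int>\<close> are encoded by their representatives in \<open>{0..<L}\<close>.\<close>

definition Z_mod :: "nat \<Rightarrow> int set" where
  "Z_mod L = {0..<int L}"

text \<open>The set \<open>\<int> + \<alpha>/L\<close> of all reals whose class mod 1 is \<open>k/L\<close> for some \<open>k \<in> \<alpha>\<close>.\<close>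

definition Z_plus_frac :: "nat \<Rightarrow> int set \<Rightarrow> real set" where
  "Z_plus_frac L \<alpha> = {of_int n + of_int k / of_nat L | n k. k \<in> \<alpha>}"

definition ae_distinct_mod_1 :: "real set \<Rightarrow> bool" where
  "ae_distinct_mod_1 S \<longleftrightarrow>
     (\<forall>n::int. n \<noteq> 0 \<longrightarrow> S \<inter> (\<lambda>t. t + of_int n) ` S \<in> null_sets lebesgue)"

text \<open>The circle \<open>\<real>/\<int>\<close> is identified with \<open>{0..<1}\<close>, the quotient map being \<^const>\<open>frac\<close>.\<close>

definition proj_T :: "real set \<Rightarrow> real set" where
  "proj_T S = frac ` S"

definition T_fiber :: "nat \<Rightarrow> real \<Rightarrow> int set \<Rightarrow> real set" where
  "T_fiber L x b = proj_T ((\<lambda>k. x + of_int k / of_nat L) ` b)"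

definition double_tiling ::
    "nat \<Rightarrow> int set \<Rightarrow> int set \<Rightarrow> int set \<Rightarrow> int set \<Rightarrow> bool" where
  "double_tiling L B C D E \<longleftrightarrow>
     (\<forall>z\<in>Z_mod L.
        card {(b, c) \<in> B \<times> C. (b + c) mod int L = z} +
        card {(d, e) \<in> D \<times> E. (d + e) mod int L = z} = 1)"

end

theory Submission
  imports Defs
begin

text \<open>
  Evaluating the tiling condition at \<open>exp t\<close> and at \<open>- exp t\<close> turns it into two additive
  conditions on the line: for almost every \<open>t\<close> there is exactly one way to write \<open>t = s + u\<close> with
  \<open>(s, u)\<close> in \<open>a\<^sup>+ \<times> \<omega>\<^sup>+\<close> or \<open>a\<^sup>- \<times> \<omega>\<^sup>-\<close>, and exactly one with the roles of \<open>\<omega>\<^sup>+\<close>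
  and \<open>\<omega>\<^sup>-\<close> exchanged. Since \<open>\<int> \<subseteq> a\<^sup>+\<close>, two points of \<open>\<omega>\<^sup>+\<close> (or of \<open>\<omega>\<^sup>-\<close>) that differ
  by an integer give two such representations, so they occur only in a null set. Reading the
  conditions at the points \<open>x + z/L\<close>, \<open>z \<in> \<int>\<^sub>L\<close>, gives the two tilings of \<open>\<int>\<^sub>L\<close>.
\<close>

section \<open>From the multiplicative tiling to two additive conditions\<close>

lemma mem_ln_pos_part [simp]: "s \<in> ln ` pos_part S \<longleftrightarrow> exp s \<in> S"
  by (force simp: pos_part_def image_iff)

lemma mem_ln_neg_part [simp]: "s \<in> ln ` neg_part S \<longleftrightarrow> - exp s \<in> S"
proof
  assume "- exp s \<in> S"
  then have "exp s \<in> neg_part S"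
    unfolding neg_part_def by (force intro!: image_eqI[where x = "- exp s"])
  then show "s \<in> ln ` neg_part S"
    by (metis image_eqI ln_exp)
qed (auto simp: neg_part_def)

text \<open>Without a hit all terms vanish and the sum is 0. Two hits give a finite partial sum 2,
  but partial sums of nonnegative terms cannot exceed the total 1.\<close>

lemma has_sum_indicator_one_imp_singleton:
  assumes "((\<lambda>a. indicat_real S (f a)) has_sum 1) A"
  shows "\<exists>a. {a \<in> A. f a \<in> S} = {a}"
proof -
  define M where "M = {a \<in> A. f a \<in> S}"
  have "M \<noteq> {}"
  proof
    assume "M = {}"
    then have "((\<lambda>a. indicat_real S (f a)) has_sum 0) A"
      by (intro has_sum_0) (auto simp: M_def indicator_def)
    then show False
      using has_sum_unique[OF assms] by force
  qed
  moreover have "a = b" if "a \<in> M" "b \<in> M" for a b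
  proof (rule ccontr)
    assume "a \<noteq> b"
    have "(\<Sum>a\<in>{a, b}. indicat_real S (f a)) \<le> 1"
      by (rule finite_sum_le_has_sum[OF assms]) (use that in \<open>auto simp: M_def\<close>)
    with \<open>a \<noteq> b\<close> that show False
      by (simp add: M_def)
  qed
  ultimately show ?thesis
    unfolding M_def[symmetric] by blast
qed

text \<open>The disjoint union of \<open>S\<close> and \<open>T\<close> is a singleton. A plain
  union would not do: one real \<open>s\<close> may lie in both logarithmic sets, coming from the
  distinct elements \<open>exp s\<close> and \<open>- exp s\<close> of \<open>A\<close>.\<close>

definition exactly_one :: "'a set \<Rightarrow> 'b set \<Rightarrow> bool" where
  "exactly_one S T \<longleftrightarrow> (\<exists>s. S = {s} \<and> T = {}) \<or> (\<exists>t. S = {} \<and> T = {t})"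

lemma exactly_one_eq:
  "exactly_one S T \<Longrightarrow> s \<in> S \<Longrightarrow> s' \<in> S \<Longrightarrow> s = s'"
  by (auto simp: exactly_one_def)

text \<open>A set with at most one element keeps its cardinality under every map.\<close>

lemma exactly_one_card_image:
  "exactly_one S T \<Longrightarrow> card (f ` S) + card (g ` T) = 1"
  by (auto simp: exactly_one_def)

text \<open>A representation \<open>t = s + u\<close> with \<open>s\<close> in \<open>a\<close> and
  \<open>u\<close> in \<omega> is determined by \<open>s\<close>, so recording \<open>s\<close>
  suffices to count representations.\<close>

definition hits :: "real set \<Rightarrow> real set \<Rightarrow> real \<Rightarrow> real set" where
  "hits a \<omega> t = {s \<in> a. t - s \<in> \<omega>}"

text \<open>For \<open>a = exp s\<close> the quotient of \<open>exp t\<close> by \<open>a\<close> is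
  \<open>exp (t - s)\<close>; for \<open>a = - exp s\<close> it is \<open>- exp (t - s)\<close>. So
  the two sets of hits parametrize the positive and the negative elements \<open>a\<close> that
  cover \<open>exp t\<close>, and the sign of the only one decides which set is inhabited.\<close>

lemma exactly_one_hits:
  assumes "0 \<notin> A" and "\<exists>a. {a \<in> A. inverse a * exp t \<in> \<Omega>} = {a}"
  shows "exactly_one (hits (ln ` pos_part A) (ln ` pos_part \<Omega>) t)
                     (hits (ln ` neg_part A) (ln ` neg_part \<Omega>) t)"
proof -
  define M where "M = {a \<in> A. inverse a * exp t \<in> \<Omega>}"
  obtain a where a: "M = {a}"
    using assms(2) by (auto simp: M_def)
  have "a \<noteq> 0"
    using a assms(1) by (auto simp: M_def)
  have p: "s \<in> hits (ln ` pos_part A) (ln ` pos_part \<Omega>) t \<longleftrightarrow> exp s \<in> M" for s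
    by (simp add: hits_def M_def exp_diff field_simps)
  have m: "s \<in> hits (ln ` neg_part A) (ln ` neg_part \<Omega>) t \<longleftrightarrow> - exp s \<in> M" for s
    by (simp add: hits_def M_def exp_diff field_simps)
  show ?thesis
  proof (cases "a > 0")
    case True
    then have "exp s = a \<longleftrightarrow> s = ln a" and "- exp s \<noteq> a" for s
      using exp_gt_zero[of s] by (auto simp del: exp_gt_zero)
    then show ?thesis
      unfolding exactly_one_def by (intro disjI1 exI[of _ "ln a"])
        (auto simp: p m a set_eq_iff)
  next
    case False
    with \<open>a \<noteq> 0\<close> have "- exp s = a \<longleftrightarrow> s = ln (- a)" and "exp s \<noteq> a" for s
      using exp_gt_zero[of s] by (auto simp del: exp_gt_zero)
    then show ?thesis
      unfolding exactly_one_def by (intro disjI2 exI[of _ "ln (- a)"])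
        (auto simp: p m a set_eq_iff)
  qed
qed

text \<open>The preimage under \<open>exp\<close> is the image of the positive part under
  \<open>ln\<close>, and differentiable maps of the line send null sets to null sets.\<close>

lemma negligible_exp_preimage:
  assumes "negligible N"
  shows "negligible {t::real. exp t \<in> N}"
proof -
  have "negligible (ln ` pos_part N)"
  proof (rule negligible_differentiable_image_negligible)
    show "negligible (pos_part N)"
      using assms by (simp add: pos_part_def negligible_Int)
    show "(ln :: real \<Rightarrow> real) differentiable_on pos_part N"
      unfolding differentiable_on_def pos_part_def
      by (auto intro!: derivative_intros differentiable_at_withinI
            simp: real_differentiable_def intro: DERIV_ln)
  qed simp
  moreover have "ln ` pos_part N = {t. exp t \<in> N}"
    using mem_ln_pos_part by blast
  ultimately show ?thesis by simp
qed

lemma uminus_image_sign_parts: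
  "pos_part (uminus ` S) = neg_part S" "neg_part (uminus ` S) = pos_part S"
  unfolding pos_part_def neg_part_def by (auto, force)

lemma multiplicative_tiling_imp_additive:
  assumes "0 \<notin> A" and "multiplicative_tiling A \<Omega>"
  obtains N :: "real set" where "negligible N"
    and "\<And>t. t \<notin> N \<Longrightarrow> exactly_one (hits (ln ` pos_part A) (ln ` pos_part \<Omega>) t)
                                     (hits (ln ` neg_part A) (ln ` neg_part \<Omega>) t)"
    and "\<And>t. t \<notin> N \<Longrightarrow> exactly_one (hits (ln ` pos_part A) (ln ` neg_part \<Omega>) t)
                                     (hits (ln ` neg_part A) (ln ` pos_part \<Omega>) t)"
proof -
  obtain E where E: "E \<in> null_sets lebesgue"
    and sub: "{x. \<not> ((\<lambda>a. indicat_real \<Omega> (inverse a * x)) has_sum 1) A} \<subseteq> E"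
    using assms(2) unfolding multiplicative_tiling_def eventually_ae_filter by auto
  have single: "\<exists>a. {a \<in> A. inverse a * x \<in> \<Omega>} = {a}" if "x \<notin> E" for x
    by (rule has_sum_indicator_one_imp_singleton) (use that sub in auto)
  have "negligible E"
    using E by (simp add: negligible_iff_null_sets)
  then have "negligible (uminus ` E)"
    by (rule negligible_differentiable_image_negligible[rotated])
       (auto simp: differentiable_on_def)
  show ?thesis
  proof (rule that)
    show "negligible ({t. exp t \<in> E} \<union> {t. exp t \<in> uminus ` E})"
      using \<open>negligible E\<close> \<open>negligible (uminus ` E)\<close>
      by (intro negligible_Un negligible_exp_preimage)
  next
    fix t assume "t \<notin> {t. exp t \<in> E} \<union> {t. exp t \<in> uminus ` E}"
    then have t: "exp t \<notin> E" "- exp t \<notin> E"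
      by (auto simp: image_iff)
    show "exactly_one (hits (ln ` pos_part A) (ln ` pos_part \<Omega>) t)
                      (hits (ln ` neg_part A) (ln ` neg_part \<Omega>) t)"
      using assms(1) single[OF t(1)] by (rule exactly_one_hits)
    \<comment> \<open>The tiling condition for \<Omega> at \<open>- exp t\<close> is the condition
      for its reflection at \<open>exp t\<close>, and reflection interchanges the two sign
      parts.\<close>
    have "y \<in> uminus ` \<Omega> \<longleftrightarrow> - y \<in> \<Omega>" for y
      by (force simp: image_iff)
    with single[OF t(2)] have "\<exists>a. {a \<in> A. inverse a * exp t \<in> uminus ` \<Omega>} = {a}"
      by simp
    from exactly_one_hits[OF assms(1) this]
    show "exactly_one (hits (ln ` pos_part A) (ln ` neg_part \<Omega>) t)
                      (hits (ln ` neg_part A) (ln ` pos_part \<Omega>) t)"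
      by (simp only: uminus_image_sign_parts)
  qed
qed

section \<open>Distinctness modulo 1\<close>

lemma of_int_mem_Z_plus_frac: "0 \<in> \<alpha> \<Longrightarrow> of_int n \<in> Z_plus_frac L \<alpha>"
  unfolding Z_plus_frac_def by force

text \<open>If both \<open>t\<close> and \<open>t - n\<close> lie in \<omega>, then 0 and
  \<open>n\<close> are two hits at \<open>t\<close>, which forces \<open>t\<close> into
  \<open>N\<close>. Leaving \<open>T\<close> arbitrary makes this applicable to both additive
  conditions.\<close>

lemma ae_distinct_mod_1I:
  assumes "negligible N" and "range of_int \<subseteq> a"
    and "\<And>t. t \<notin> N \<Longrightarrow> exactly_one (hits a \<omega> t) (T t)"
  shows "ae_distinct_mod_1 \<omega>"
  unfolding ae_distinct_mod_1_def
proof (intro allI impI)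
  fix n :: int assume "n \<noteq> 0"
  have "\<omega> \<inter> (\<lambda>t. t + of_int n) ` \<omega> \<subseteq> N"
  proof
    fix t assume "t \<in> \<omega> \<inter> (\<lambda>t. t + of_int n) ` \<omega>"
    moreover have "of_int m \<in> a" for m
      using assms(2) by (rule subsetD) simp
    from this[of 0] this[of n] have "0 \<in> a" "of_int n \<in> a"
      by simp_all
    ultimately have "0 \<in> hits a \<omega> t" "of_int n \<in> hits a \<omega> t"
      by (auto simp: hits_def)
    then show "t \<in> N"
      using exactly_one_eq[OF assms(3)] \<open>n \<noteq> 0\<close> by (metis of_int_eq_0_iff)
  qed
  then show "\<omega> \<inter> (\<lambda>t. t + of_int n) ` \<omega> \<in> null_sets lebesgue"
    using negligible_subset[OF assms(1)] by (simp add: negligible_iff_null_sets)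
qed

section \<open>Fibres of the circle over [0, 1/L) and tilings of the residues\<close>

definition fiber_residues :: "nat \<Rightarrow> real set \<Rightarrow> real \<Rightarrow> int set" where
  "fiber_residues L \<omega> x = {k \<in> Z_mod L. x + of_int k / of_nat L \<in> proj_T \<omega>}"

context
  fixes L :: nat
  assumes L: "L > 0"
begin

text \<open>Integrality sharpens \<open>k < L\<close> to \<open>k + 1 \<le> L\<close>, so
  \<open>x < 1 / L\<close> keeps the point below 1: it is its own representative on the
  circle.\<close>

lemma frac_fiber_point:
  assumes "x \<in> {0..<1 / real L}" "k \<in> Z_mod L"
  shows "frac (x + of_int k / of_nat L) = x + of_int k / of_nat L"
proof -
  have "0 \<le> real_of_int k" "of_int k + 1 \<le> real L"
    using assms(2) by (auto simp: Z_mod_def)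
  then have "0 \<le> x + of_int k / of_nat L" "x + of_int k / of_nat L < 1"
    using assms(1) L by (auto simp: field_simps)
  then show ?thesis
    by (simp add: frac_eq)
qed

lemma T_fiber_fiber_residues:
  assumes "x \<in> {0..<1 / real L}"
  shows "T_fiber L x (fiber_residues L \<omega> x)
           = (\<lambda>k. x + of_int k / of_nat L) ` fiber_residues L \<omega> x"
  unfolding T_fiber_def proj_T_def image_image
  by (intro image_cong) (use assms in \<open>auto simp: fiber_residues_def frac_fiber_point\<close>)

text \<open>Since \<open>L * x\<close> lies in [0, 1), \<open>k\<close> is the integer part of
  \<open>L * x + k\<close>; the point therefore determines \<open>k\<close>, and then
  \<open>x\<close>.\<close>

lemma fiber_point_inj:
  assumes "x \<in> {0..<1 / real L}" "y \<in> {0..<1 / real L}"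
    and "x + of_int k / of_nat L = y + of_int j / of_nat L"
  shows "x = y"
proof -
  have eq: "L * x + of_int k = L * y + of_int j"
    using assms(3) L by (simp add: field_simps)
  have "\<lfloor>L * x + of_int k\<rfloor> = k" "\<lfloor>L * y + of_int j\<rfloor> = j"
    using assms(1,2) L by (auto simp: floor_eq_iff field_simps)
  with eq have "k = j" by simp
  with assms(3) show "x = y" by simp
qed

lemma disjoint_family_T_fiber:
  "disjoint_family_on (\<lambda>x. T_fiber L x (fiber_residues L \<omega> x)) {0..<1 / real L}"
  unfolding disjoint_family_on_def
  by (auto simp: T_fiber_fiber_residues dest: fiber_point_inj[rotated 2])

lemma proj_T_eq_Union_T_fiber:
  "proj_T \<omega> = (\<Union>x\<in>{0..<1 / real L}. T_fiber L x (fiber_residues L \<omega> x))"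
proof
  show "proj_T \<omega> \<subseteq> (\<Union>x\<in>{0..<1 / real L}. T_fiber L x (fiber_residues L \<omega> x))"
  proof
    fix y assume y: "y \<in> proj_T \<omega>"
    then have y01: "0 \<le> y" "y < 1"
      by (auto simp: proj_T_def frac_lt_1)
    \<comment> \<open>Division of \<open>y\<close> by \<open>1 / L\<close> with remainder
      \<open>x\<close>; \<open>y < 1\<close> makes the quotient \<open>k\<close> a residue.\<close>
    define k where "k = \<lfloor>L * y\<rfloor>"
    define x where "x = y - of_int k / of_nat L"
    have "of_int k \<le> L * y" "L * y < of_int k + 1"
      by (auto simp: k_def)
    then have "0 \<le> L * x" "L * x < 1"
      using L by (auto simp: x_def right_diff_distrib)
    then have x: "x \<in> {0..<1 / real L}"
      using L by (auto simp: zero_le_mult_iff field_simps)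
    have "L * y < L" using y01 L by simp
    then have "k \<in> Z_mod L"
      using y01 by (simp add: Z_mod_def k_def floor_less_iff)
    then have "k \<in> fiber_residues L \<omega> x"
      using y by (simp add: fiber_residues_def x_def)
    then have "y \<in> T_fiber L x (fiber_residues L \<omega> x)"
      unfolding T_fiber_fiber_residues[OF x] by (rule rev_image_eqI) (simp add: x_def)
    with x show "y \<in> (\<Union>x\<in>{0..<1 / real L}. T_fiber L x (fiber_residues L \<omega> x))"
      by blast
  qed
  show "(\<Union>x\<in>{0..<1 / real L}. T_fiber L x (fiber_residues L \<omega> x)) \<subseteq> proj_T \<omega>"
    by (auto simp: T_fiber_fiber_residues) (auto simp: fiber_residues_def)
qed

text \<open>For a hit \<open>s\<close>, the number \<open>L * s\<close> is an integer whose residue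
  is \<open>c\<close>, and the point \<open>x + z / L - s\<close> of \<omega> lies over the residue
  of \<open>z - L * s\<close>, which is \<open>b\<close>. The floor only turns \<open>L * s\<close>
  into an \<open>int\<close>. An image suffices, because \<open>exactly_one\<close> carries the
  count across.\<close>

lemma residue_pairs_eq_image_hits:
  assumes x: "x \<in> {0..<1 / real L}" and z: "z \<in> Z_mod L" and \<alpha>: "\<alpha> \<subseteq> Z_mod L"
  shows "{(b, c) \<in> fiber_residues L \<omega> x \<times> \<alpha>. (b + c) mod int L = z}
     = (\<lambda>s. ((z - \<lfloor>L * s\<rfloor>) mod int L, \<lfloor>L * s\<rfloor> mod int L))
         ` hits (Z_plus_frac L \<alpha>) \<omega> (x + of_int z / of_nat L)" (is "?P = ?f ` ?H")
proof (intro equalityI subsetI)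
  have red: "c mod int L = c" if "c \<in> Z_mod L" for c
    using that by (simp add: Z_mod_def)
  fix p assume "p \<in> ?P"
  then obtain b c where p: "p = (b, c)" and b: "b \<in> fiber_residues L \<omega> x" and c: "c \<in> \<alpha>"
    and bc: "(b + c) mod int L = z" by auto
  from b obtain u where u: "u \<in> \<omega>" "x + of_int b / of_nat L = frac u" and bZ: "b \<in> Z_mod L"
    by (auto simp: fiber_residues_def proj_T_def)
  define q where "q = (b + c) div int L"
  have "b + c = z + int L * q"
    unfolding q_def bc[symmetric] by simp
  then have bcq: "of_int b = of_int z + real L * of_int q - of_int c"
    by (metis add_diff_cancel_right' of_int_add of_int_mult of_int_of_nat_eq)
  \<comment> \<open>Solving \<open>x + z / L - s = u\<close> for \<open>s\<close>, using
    \<open>u = x + b / L + \<lfloor>u\<rfloor>\<close> and \<open>b + c = z + L * q\<close>.\<close>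
  define s :: real where "s = of_int (- q - \<lfloor>u\<rfloor>) + of_int c / of_nat L"
  have "x + of_int z / of_nat L - s = u"
    using u(2) L by (simp add: s_def bcq frac_def add_divide_distrib diff_divide_distrib)
  moreover have "s \<in> Z_plus_frac L \<alpha>"
    using c unfolding Z_plus_frac_def s_def by blast
  ultimately have "s \<in> ?H"
    using u(1) by (simp add: hits_def)
  have Ls: "\<lfloor>L * s\<rfloor> = c + int L * (- q - \<lfloor>u\<rfloor>)"
  proof -
    have "L * s = of_int (c + int L * (- q - \<lfloor>u\<rfloor>))"
      using L by (simp add: s_def field_simps)
    then show ?thesis by (metis floor_of_int)
  qed
  have "?f s = p"
  proof -
    have "\<lfloor>L * s\<rfloor> mod int L = c"
      using c \<alpha> red by (auto simp: Ls)
    moreover have "z - \<lfloor>L * s\<rfloor> = b + int L * \<lfloor>u\<rfloor>"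
      using \<open>b + c = z + int L * q\<close> unfolding Ls by (simp add: algebra_simps)
    then have "(z - \<lfloor>L * s\<rfloor>) mod int L = b"
      using bZ red by simp
    ultimately show ?thesis by (simp add: p)
  qed
  with \<open>s \<in> ?H\<close> show "p \<in> ?f ` ?H" by blast
next
  fix p assume "p \<in> ?f ` ?H"
  then obtain s where p: "p = ?f s" and s: "s \<in> Z_plus_frac L \<alpha>"
    and sw: "x + of_int z / of_nat L - s \<in> \<omega>"
    by (auto simp: hits_def)
  from s obtain n c where c: "c \<in> \<alpha>" and s_eq: "s = of_int n + of_int c / of_nat L"
    by (auto simp: Z_plus_frac_def)
  have "L * s = of_int (c + int L * n)"
    using L by (simp add: s_eq field_simps)
  then have Ls: "\<lfloor>L * s\<rfloor> = c + int L * n"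
    by (metis floor_of_int)
  define b where "b = (z - \<lfloor>L * s\<rfloor>) mod int L"
  have "\<lfloor>L * s\<rfloor> mod int L = c"
    using c \<alpha> by (auto simp: Ls Z_mod_def)
  then have p': "p = (b, c)"
    by (simp add: p b_def)
  have bZ: "b \<in> Z_mod L"
    using L by (simp add: b_def Z_mod_def)
  have "(b + c) mod int L = (z - \<lfloor>L * s\<rfloor> + c) mod int L"
    by (simp add: b_def mod_simps)
  also have "z - \<lfloor>L * s\<rfloor> + c = z + int L * (- n)"
    by (simp add: Ls)
  also have "\<dots> mod int L = z"
    using z by (simp only: mod_mult_self2) (simp add: Z_mod_def)
  finally have bc: "(b + c) mod int L = z" .
  \<comment> \<open>The point of \<omega> is \<open>x + b / L + q\<close>, so \<open>q\<close> is
    the integer translation removed by the projection.\<close>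
  define q where "q = (z - \<lfloor>L * s\<rfloor>) div int L"
  have "z - \<lfloor>L * s\<rfloor> = b + int L * q"
    by (simp add: b_def q_def)
  then have "of_int z - L * s = of_int b + real L * of_int q"
    by (metis Ls \<open>L * s = of_int (c + int L * n)\<close> of_int_add of_int_diff of_int_mult of_int_of_nat_eq)
  then have "x + of_int z / of_nat L - s = (x + of_int b / of_nat L) + of_int q"
    using L by (simp add: field_simps)
  then have "frac (x + of_int z / of_nat L - s) = x + of_int b / of_nat L"
    using frac_fiber_point[OF x bZ] by (simp only: frac_add_of_int_right)
  then have "b \<in> fiber_residues L \<omega> x"
    using bZ sw unfolding fiber_residues_def proj_T_def
    by (metis (mono_tags, lifting) image_eqI mem_Collect_eq)
  with c bc show "p \<in> ?P" by (simp add: p')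
qed

lemma double_tilingI:
  assumes "x \<in> {0..<1 / real L}" "\<alpha> \<subseteq> Z_mod L" "\<beta> \<subseteq> Z_mod L"
    and "\<And>z. z \<in> Z_mod L \<Longrightarrow>
           exactly_one (hits (Z_plus_frac L \<alpha>) \<omega> (x + of_int z / of_nat L))
                       (hits (Z_plus_frac L \<beta>) \<psi> (x + of_int z / of_nat L))"
  shows "double_tiling L (fiber_residues L \<omega> x) \<alpha> (fiber_residues L \<psi> x) \<beta>"
  unfolding double_tiling_def
proof
  fix z assume z: "z \<in> Z_mod L"
  show "card {(b, c) \<in> fiber_residues L \<omega> x \<times> \<alpha>. (b + c) mod int L = z} +
        card {(d, e) \<in> fiber_residues L \<psi> x \<times> \<beta>. (d + e) mod int L = z} = 1"
    unfolding residue_pairs_eq_image_hits[OF assms(1) z assms(2)]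
      residue_pairs_eq_image_hits[OF assms(1) z assms(3)]
    by (rule exactly_one_card_image[OF assms(4)[OF z]])
qed

end

section \<open>Exceptional base points and conclusion\<close>

lemma AE_translates_notin:
  assumes "negligible (N :: real set)" and "countable I"
  shows "AE x in lebesgue. \<forall>i\<in>I. x + f i \<notin> N"
proof -
  have "AE x in lebesgue. x + f i \<notin> N" for i
  proof (rule AE_I')
    \<comment> \<open>The bad \<open>x\<close> for \<open>i\<close> form the translate of
      \<open>N\<close> by \<open>- f i\<close>.\<close>
    show "(\<lambda>x. - f i + x) ` N \<in> null_sets lebesgue"
      using negligible_translation[OF assms(1)] unfolding negligible_iff_null_sets .
  qed (force simp: image_iff)
  then show ?thesis
    using assms(2) by (simp add: AE_ball_countable)
qed

theorem mainTheorem2: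
  fixes \<Omega> A :: "real set" and \<epsilon> :: real and L :: nat and \<alpha>\<^sub>p \<alpha>\<^sub>m :: "int set"
  assumes "bounded \<Omega>" and "\<Omega> \<in> sets lebesgue"
    and "\<epsilon> > 0" and "\<Omega> \<inter> {-\<epsilon><..<\<epsilon>} = {}"
    and "0 \<notin> A" and "discrete A"
    and "multiplicative_tiling A \<Omega>"
    and "emeasure lebesgue (sym_diff (pos_part \<Omega>) (neg_part \<Omega>)) > 0"
    and "L > 0"
    and "\<alpha>\<^sub>p \<subseteq> Z_mod L" and "\<alpha>\<^sub>m \<subseteq> Z_mod L" and "0 \<in> \<alpha>\<^sub>p"
    and "ln ` pos_part A = Z_plus_frac L \<alpha>\<^sub>p"
    and "ln ` neg_part A = Z_plus_frac L \<alpha>\<^sub>m"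
  shows "ae_distinct_mod_1 (ln ` pos_part \<Omega>) \<and>
    ae_distinct_mod_1 (ln ` neg_part \<Omega>) \<and>
    (\<exists>b\<^sub>p b\<^sub>m :: real \<Rightarrow> int set.
       (\<forall>x\<in>{0..<1 / real L}. b\<^sub>p x \<subseteq> Z_mod L \<and> b\<^sub>m x \<subseteq> Z_mod L) \<and>
       proj_T (ln ` pos_part \<Omega>) = (\<Union>x\<in>{0..<1 / real L}. T_fiber L x (b\<^sub>p x)) \<and>
       proj_T (ln ` neg_part \<Omega>) = (\<Union>x\<in>{0..<1 / real L}. T_fiber L x (b\<^sub>m x)) \<and>
       disjoint_family_on (\<lambda>x. T_fiber L x (b\<^sub>p x)) {0..<1 / real L} \<and>
       disjoint_family_on (\<lambda>x. T_fiber L x (b\<^sub>m x)) {0..<1 / real L} \<and>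
       (AE x\<in>{0..<1 / real L} in lebesgue.
          double_tiling L (b\<^sub>p x) \<alpha>\<^sub>p (b\<^sub>m x) \<alpha>\<^sub>m \<and>
          double_tiling L (b\<^sub>p x) \<alpha>\<^sub>m (b\<^sub>m x) \<alpha>\<^sub>p))"
proof -
  let ?\<omega>\<^sub>p = "ln ` pos_part \<Omega>" and ?\<omega>\<^sub>m = "ln ` neg_part \<Omega>"
  obtain N :: "real set" where N: "negligible N"
    and pp: "\<And>t. t \<notin> N \<Longrightarrow> exactly_one (hits (Z_plus_frac L \<alpha>\<^sub>p) ?\<omega>\<^sub>p t)
                                         (hits (Z_plus_frac L \<alpha>\<^sub>m) ?\<omega>\<^sub>m t)"
    and pm: "\<And>t. t \<notin> N \<Longrightarrow> exactly_one (hits (Z_plus_frac L \<alpha>\<^sub>p) ?\<omega>\<^sub>m t)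
                                         (hits (Z_plus_frac L \<alpha>\<^sub>m) ?\<omega>\<^sub>p t)"
    using multiplicative_tiling_imp_additive[OF assms(5,7)] unfolding assms(13,14) by metis
  \<comment> \<open>\<open>exactly_one\<close> is symmetric; this order puts
    \<open>?\<omega>\<^sub>p\<close> first, as in the second tiling.\<close>
  have mp: "exactly_one (hits (Z_plus_frac L \<alpha>\<^sub>m) ?\<omega>\<^sub>p t)
                        (hits (Z_plus_frac L \<alpha>\<^sub>p) ?\<omega>\<^sub>m t)" if "t \<notin> N" for t
    using pm[OF that] by (auto simp: exactly_one_def)
  have Z: "range of_int \<subseteq> Z_plus_frac L \<alpha>\<^sub>p"
    using assms(12) by (auto intro: of_int_mem_Z_plus_frac)
  \<comment> \<open>A tiling over \<open>x\<close> uses the additive condition at the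
    \<open>L\<close> points \<open>x + z / L\<close>, so all of them must avoid
    \<open>N\<close>.\<close>
  have "countable (Z_mod L)" by simp
  from AE_translates_notin[OF N this, of "\<lambda>z. of_int z / of_nat L"]
  have tilings: "AE x\<in>{0..<1 / real L} in lebesgue.
      double_tiling L (fiber_residues L ?\<omega>\<^sub>p x) \<alpha>\<^sub>p (fiber_residues L ?\<omega>\<^sub>m x) \<alpha>\<^sub>m \<and>
      double_tiling L (fiber_residues L ?\<omega>\<^sub>p x) \<alpha>\<^sub>m (fiber_residues L ?\<omega>\<^sub>m x) \<alpha>\<^sub>p"
  proof (eventually_elim, intro impI conjI)
    fix x
    assume N: "\<forall>z\<in>Z_mod L. x + of_int z / of_nat L \<notin> N" and x: "x \<in> {0..<1 / real L}"
    show "double_tiling L (fiber_residues L ?\<omega>\<^sub>p x) \<alpha>\<^sub>p (fiber_residues L ?\<omega>\<^sub>m x) \<alpha>\<^sub>m"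
      using N by (intro double_tilingI[OF assms(9) x assms(10,11)] pp) blast
    show "double_tiling L (fiber_residues L ?\<omega>\<^sub>p x) \<alpha>\<^sub>m (fiber_residues L ?\<omega>\<^sub>m x) \<alpha>\<^sub>p"
      using N by (intro double_tilingI[OF assms(9) x assms(11,10)] mp) blast
  qed
  show ?thesis
    by (intro conjI exI[of _ "fiber_residues L ?\<omega>\<^sub>p"] exI[of _ "fiber_residues L ?\<omega>\<^sub>m"]
          ae_distinct_mod_1I[OF N Z pp] ae_distinct_mod_1I[OF N Z pm]
          proj_T_eq_Union_T_fiber[OF assms(9)] disjoint_family_T_fiber[OF assms(9)] tilings)
       (auto simp: fiber_residues_def)
qed

end
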